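(* Let $0\le\lambda<n$ and $1\le p<\infty$. Every function in $V^{(\ast)}_{0,\infty}L^{p,\lambda}$ can be approximated in the norm $\|\cdot\|_{p,\lambda}$ by functions in $C_0^\infty(\mathbb{R}^n)$.
   Context: $B(x,r)$ is the open ball in $\mathbb{R}^n$ with center $x$ and radius $r$. For $f\in L^1_{\mathrm{loc}}(\mathbb{R}^n)$ let $\mathfrak{M}_{p,\lambda}(f;x,r):=r^{-\lambda}\int_{B(x,r)}|f(y)|^p\,dy$. The homogeneous Morrey space $L^{p,\lambda}(\mathbb{R}^n)$ consists of $f\in L^p_{\mathrm{loc}}(\mathbb{R}^n)$ with $\|f\|_{p,\lambda}:=\sup_{x\in\mathbb{R}^n,\,r>0}\mathfrak{M}_{p,\lambda}(f;x,r)^{1/p}<\infty$. Subsets of $L^{p,\lambda}$: $V_0L^{p,\lambda}=\{f:\lim_{r\to0}\sup_{x}\mathfrak{M}_{p,\lambda}(f;x,r)=0\}$; $V_\infty L^{p,\lambda}=\{f:\lim_{r\to\infty}\sup_{x}\mathfrak{M}_{p,\lambda}(f;x,r)=0\}$; $V^{(\ast)}L^{p,\lambda}=\{f:\lim_{N\to\infty}\sup_{x}\int_{B(x,1)}|f(y)|^p\chi_{\mathbb{R}^n\setminus B(0,N)}(y)\,dy=0\}$; $V^{(\ast)}_{0,\infty}L^{p,\lambda}:=V_0L^{p,\lambda}\cap V_\infty L^{p,\lambda}\cap V^{(\ast)}L^{p,\lambda}$. *)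

theory Defs
  imports "HOL-Analysis.Analysis"
begin

definition morrey_M :: "real \<Rightarrow> real \<Rightarrow> ('a::euclidean_space \<Rightarrow> real) \<Rightarrow> 'a \<Rightarrow> real \<Rightarrow> ennreal" where
  "morrey_M p lam f x r =
     ennreal (r powr (- lam)) * (\<integral>\<^sup>+ y \<in> ball x r. ennreal (\<bar>f y\<bar> powr p) \<partial>lborel)"

definition morrey_sup :: "real \<Rightarrow> real \<Rightarrow> ('a::euclidean_space \<Rightarrow> real) \<Rightarrow> ennreal" where
  "morrey_sup p lam f = (SUP (x, r) \<in> UNIV \<times> {0<..}. morrey_M p lam f x r)"

definition Lp_loc :: "real \<Rightarrow> ('a::euclidean_space \<Rightarrow> real) \<Rightarrow> bool" where
  "Lp_loc p f \<longleftrightarrow> f \<in> borel_measurable lebesgue \<and>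
     (\<forall>K. compact K \<longrightarrow> (\<integral>\<^sup>+ y \<in> K. ennreal (\<bar>f y\<bar> powr p) \<partial>lborel) < \<infinity>)"

definition morrey_space :: "real \<Rightarrow> real \<Rightarrow> ('a::euclidean_space \<Rightarrow> real) set" where
  "morrey_space p lam = {f. Lp_loc p f \<and> morrey_sup p lam f < \<infinity>}"

text \<open>The Morrey norm (meaningful for f in the Morrey space, where the sup is finite).\<close>
definition morrey_norm :: "real \<Rightarrow> real \<Rightarrow> ('a::euclidean_space \<Rightarrow> real) \<Rightarrow> real" where
  "morrey_norm p lam f = (enn2real (morrey_sup p lam f)) powr (1 / p)"

definition V0_morrey :: "real \<Rightarrow> real \<Rightarrow> ('a::euclidean_space \<Rightarrow> real) set" where
  "V0_morrey p lam = {f \<in> morrey_space p lam.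
     ((\<lambda>r. SUP x. morrey_M p lam f x r) \<longlongrightarrow> 0) (at_right 0)}"

definition Vinf_morrey :: "real \<Rightarrow> real \<Rightarrow> ('a::euclidean_space \<Rightarrow> real) set" where
  "Vinf_morrey p lam = {f \<in> morrey_space p lam.
     ((\<lambda>r. SUP x. morrey_M p lam f x r) \<longlongrightarrow> 0) at_top}"

definition Vstar_morrey :: "real \<Rightarrow> real \<Rightarrow> ('a::euclidean_space \<Rightarrow> real) set" where
  "Vstar_morrey p lam = {f \<in> morrey_space p lam.
     ((\<lambda>N::nat. SUP x. \<integral>\<^sup>+ y \<in> ball x 1.
          ennreal (\<bar>f y\<bar> powr p) * indicator (- ball 0 (real N)) y \<partial>lborel) \<longlonglongrightarrow> 0)}"

definition V0inf_star_morrey :: "real \<Rightarrow> real \<Rightarrow> ('a::euclidean_space \<Rightarrow> real) set" where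
  "V0inf_star_morrey p lam = V0_morrey p lam \<inter> Vinf_morrey p lam \<inter> Vstar_morrey p lam"

definition pdir :: "'a::euclidean_space \<Rightarrow> ('a \<Rightarrow> real) \<Rightarrow> 'a \<Rightarrow> real" where
  "pdir v g = (\<lambda>x. frechet_derivative g (at x) v)"

definition Cinf :: "('a::euclidean_space \<Rightarrow> real) \<Rightarrow> bool" where
  "Cinf f \<longleftrightarrow> (\<forall>ds. set ds \<subseteq> Basis \<longrightarrow>
      (\<forall>x. foldr pdir ds f differentiable (at x)))"

definition C0_inf :: "('a::euclidean_space \<Rightarrow> real) set" where
  "C0_inf = {g. Cinf g \<and> compact (closure {x. g x \<noteq> 0})}"

end

theory Submission
  imports Defs
begin

text \<open>
  No mollification is needed. Cutting f off outside a large ball changes it little in the Morrey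
  norm: small radii are controlled by the vanishing property at 0, large ones by that at infinity,
  and intermediate ones by covering a ball with boundedly many unit balls. The cut-off function h
  lies in the usual Lebesgue space, and whenever \<open>\<bar>h - s\<bar> \<le> 3 \<bar>h\<bar>\<close> the small radii are again harmless, so
  convergence of simple functions s to h there suffices. For the indicator of a bounded set the small
  radii are harmless because the constant function 1 vanishes at 0 in the Morrey sense (this is
  where \<open>lam < n\<close> enters); by regularity such a set can be replaced by a finite union of balls, whose
  indicator is the limit of \<open>1 - (1 - s) ^ k\<close> for a sum s of bump functions.
\<close>

section \<open>An algebra of smooth functions\<close>

text \<open>The flat function exp(-1/t), extended by 0 to t \<le> 0, times the powers of 1/t that
  differentiation produces.\<close>

definition flat_exp :: "nat \<Rightarrow> real \<Rightarrow> real" where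
  "flat_exp j t = (if 0 < t then exp (- inverse t) * inverse t ^ j else 0)"

text \<open>Substituting 1/t reduces this to the exponential outgrowing every power at
  infinity.\<close>

lemma tendsto_flat_exp_right: "(flat_exp j \<longlongrightarrow> 0) (at_right 0)"
proof -
  have "((\<lambda>t. inverse t ^ j / exp (inverse t)) \<longlongrightarrow> (0::real)) (at_right 0)"
    by (rule filterlim_compose[OF tendsto_power_div_exp_0 filterlim_inverse_at_top_right])
  moreover have "\<forall>\<^sub>F t in at_right 0. inverse t ^ j / exp (inverse t) = flat_exp j t"
    by (auto simp: flat_exp_def eventually_at_filter exp_minus field_simps)
  ultimately show ?thesis
    by (rule Lim_transform_eventually)
qed

text \<open>Away from 0 this is the product and chain rule. At 0 both sides of the formula vanish,
  and flatness makes both one-sided difference quotients tend to 0.\<close>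

lemma has_real_derivative_flat_exp:
  "(flat_exp j has_real_derivative flat_exp (j + 2) t - real j * flat_exp (j + 1) t) (at t)"
proof -
  consider "t > 0" | "t < 0" | "t = 0" by linarith
  then show ?thesis
  proof cases
    case 1
    have "((\<lambda>t. exp (- inverse t) * inverse t ^ j) has_real_derivative
        flat_exp (j + 2) t - real j * flat_exp (j + 1) t) (at t)"
      using 1
      by (cases j) (auto intro!: derivative_eq_intros simp: flat_exp_def field_simps power2_eq_square,
          metis One_nat_def gr0I mult.commute power_minus_mult)
    then show ?thesis
      by (rule has_field_derivative_transform_within_open[where S = "{0<..}"])
        (use 1 in \<open>auto simp: flat_exp_def\<close>)
  next
    case 2
    have "((\<lambda>t. 0) has_real_derivative flat_exp (j + 2) t - real j * flat_exp (j + 1) t) (at t)"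
      using 2 by (auto simp: flat_exp_def)
    then show ?thesis
      by (rule has_field_derivative_transform_within_open[where S = "{..<0}"])
        (use 2 in \<open>auto simp: flat_exp_def\<close>)
  next
    case 3
    \<comment> \<open>Dividing by y > 0 raises the power of 1/y by one, so the quotient is
      \<open>flat_exp (Suc j) y\<close>.\<close>
    have "((\<lambda>y. (flat_exp j y - flat_exp j 0) / (y - 0)) \<longlongrightarrow> 0) (at_right 0)"
      by (rule Lim_transform_eventually[OF tendsto_flat_exp_right[of "Suc j"]])
        (auto simp: flat_exp_def eventually_at_filter field_simps)
    moreover have "((\<lambda>y. (flat_exp j y - flat_exp j 0) / (y - 0)) \<longlongrightarrow> 0) (at_left 0)"
      by (rule Lim_transform_eventually[OF tendsto_const])
        (auto simp: flat_exp_def eventually_at_filter)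
    ultimately have "((\<lambda>y. (flat_exp j y - flat_exp j 0) / (y - 0)) \<longlongrightarrow> 0) (at 0)"
      by (rule filterlim_split_at[rotated])
    then show ?thesis
      unfolding 3 by (simp add: has_field_derivative_iff flat_exp_def)
  qed
qed

text \<open>Closed under directional derivatives because the functions \<open>flat_exp j\<close> form a family closed
  under differentiation up to linear combinations.\<close>
inductive bump_algebra :: "('a::euclidean_space \<Rightarrow> real) \<Rightarrow> bool" where
  const: "bump_algebra (\<lambda>x. c)"
| inner: "bump_algebra (\<lambda>x. x \<bullet> b)"
| flat_exp: "bump_algebra (\<lambda>x. flat_exp j (c - (x - a) \<bullet> (x - a)))"
| add: "bump_algebra f \<Longrightarrow> bump_algebra g \<Longrightarrow> bump_algebra (\<lambda>x. f x + g x)"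
| mult: "bump_algebra f \<Longrightarrow> bump_algebra g \<Longrightarrow> bump_algebra (\<lambda>x. f x * g x)"

lemma bump_algebra_sum:
  "finite A \<Longrightarrow> (\<And>i. i \<in> A \<Longrightarrow> bump_algebra (f i)) \<Longrightarrow> bump_algebra (\<lambda>x. \<Sum>i\<in>A. f i x)"
  by (induction A rule: finite_induct) (auto intro: bump_algebra.intros)

lemma bump_algebra_power: "bump_algebra f \<Longrightarrow> bump_algebra (\<lambda>x. f x ^ k)"
  by (induction k) (auto intro: bump_algebra.intros)

text \<open>Induction over the generators and operations. Membership of each directional derivative
  in the algebra is carried along so that differentiation can be iterated.\<close>

lemma bump_algebra_has_derivative:
  assumes "bump_algebra f"
  shows "\<exists>D. (\<forall>x. (f has_derivative D x) (at x)) \<and> (\<forall>v. bump_algebra (\<lambda>x. D x v))"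
  using assms
proof induction
  case (const c)
  then show ?case
    by (intro exI[of _ "\<lambda>x v. 0"]) (auto intro: bump_algebra.intros)
next
  case (inner b)
  show ?case
    by (intro exI[of _ "\<lambda>x v. v \<bullet> b"]) (auto intro!: derivative_eq_intros bump_algebra.intros)
next
  case (flat_exp j c a)
  let ?q = "\<lambda>x. c - (x - a) \<bullet> (x - a)"
  \<comment> \<open>Differences are written as sums with negative constant factors, which lets the
    introduction rules of \<open>bump_algebra\<close> match the term directly.\<close>
  define D where "D x v = (flat_exp (j + 2) (?q x) + (- real j) * flat_exp (j + 1) (?q x)) *
      ((- 2) * (x \<bullet> v + (- (a \<bullet> v))))" for x v :: 'a
  have "((\<lambda>x. flat_exp j (?q x)) has_derivative D x) (at x)" for x
  proof -
    have "(?q has_derivative (\<lambda>v. (- 2) * (x \<bullet> v + (- (a \<bullet> v))))) (at x)"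
      by (auto intro!: derivative_eq_intros simp: inner_commute algebra_simps)
    from has_derivative_compose[OF this has_field_derivative_imp_has_derivative[OF has_real_derivative_flat_exp]]
    show ?thesis
      by (simp add: D_def[abs_def])
  qed
  moreover have "bump_algebra (\<lambda>x. D x v)" for v
    unfolding D_def by (intro bump_algebra.intros)
  ultimately show ?case by blast
next
  case (add f g)
  then obtain D E where
    D: "\<And>x. (f has_derivative D x) (at x)" "\<And>v. bump_algebra (\<lambda>x. D x v)" and
    E: "\<And>x. (g has_derivative E x) (at x)" "\<And>v. bump_algebra (\<lambda>x. E x v)" by blast
  show ?case
    by (intro exI[of _ "\<lambda>x v. D x v + E x v"])
      (use D E in \<open>auto intro!: derivative_eq_intros bump_algebra.intros\<close>)
next
  case (mult f g)
  then obtain D E where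
    D: "\<And>x. (f has_derivative D x) (at x)" "\<And>v. bump_algebra (\<lambda>x. D x v)" and
    E: "\<And>x. (g has_derivative E x) (at x)" "\<And>v. bump_algebra (\<lambda>x. E x v)" by blast
  have "bump_algebra (\<lambda>x. f x * E x v + D x v * g x)" for v
    using mult D E by (intro bump_algebra.intros)
  moreover have "((\<lambda>x. f x * g x) has_derivative (\<lambda>v. f x * E x v + D x v * g x)) (at x)" for x
    by (rule has_derivative_mult[OF D(1) E(1)])
  ultimately show ?case
    by (intro exI[of _ "\<lambda>x v. f x * E x v + D x v * g x"]) auto
qed

lemma bump_algebra_continuous_on: "bump_algebra f \<Longrightarrow> continuous_on S f"
  by (meson bump_algebra_has_derivative has_derivative_continuous continuous_at_imp_continuous_on)

text \<open>Uniqueness of the Frechet derivative identifies \<open>pdir v f\<close> with the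
  derivative found by induction.\<close>

lemma bump_algebra_pdir:
  assumes "bump_algebra f"
  shows "bump_algebra (pdir v f)"
proof -
  obtain D where D: "\<And>x. (f has_derivative D x) (at x)" "\<And>v. bump_algebra (\<lambda>x. D x v)"
    using bump_algebra_has_derivative[OF assms] by blast
  have "pdir v f = (\<lambda>x. D x v)"
    using frechet_derivative_at[OF D(1)] by (simp add: pdir_def fun_eq_iff)
  with D(2) show ?thesis by simp
qed

lemma bump_algebra_imp_Cinf: assumes "bump_algebra f" shows "Cinf f"
proof -
  have "bump_algebra (foldr pdir ds f)" for ds
    by (induction ds) (auto intro: assms bump_algebra_pdir)
  then show ?thesis
    unfolding Cinf_def using bump_algebra_has_derivative differentiable_def by metis
qed

section \<open>Morrey functionals\<close>

text \<open>The functions are only Lebesgue measurable, so additivity of the integral needs the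
  completed measure.\<close>
lemma morrey_M_lebesgue:
  "morrey_M p lam f x r =
    ennreal (r powr (- lam)) * (\<integral>\<^sup>+ y \<in> ball x r. ennreal (\<bar>f y\<bar> powr p) \<partial>lebesgue)"
  by (simp add: morrey_M_def nn_integral_completion)

lemma morrey_M_le_morrey_sup: "0 < r \<Longrightarrow> morrey_M p lam f x r \<le> morrey_sup p lam f"
  unfolding morrey_sup_def by (rule SUP_upper2[of "(x, r)"]) auto

lemma morrey_sup_leI:
  "(\<And>x r. 0 < r \<Longrightarrow> morrey_M p lam f x r \<le> e) \<Longrightarrow> morrey_sup p lam f \<le> e"
  unfolding morrey_sup_def by (rule SUP_least) auto

lemma morrey_M_mono:
  assumes "0 \<le> p" "\<And>y. \<bar>f y\<bar> \<le> \<bar>g y\<bar>"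
  shows "morrey_M p lam f x r \<le> morrey_M p lam g x r"
  unfolding morrey_M_def
  by (intro mult_left_mono nn_integral_mono mult_right_mono ennreal_leI powr_mono2)
    (use assms in auto)

text \<open>For radii bounded away from 0 the weight is at most \<open>d powr (- lam)\<close>,
  because lam \<ge> 0, so the global integral controls the functional uniformly in the
  centre.\<close>

lemma morrey_M_le_nn_integral:
  assumes "0 \<le> lam" "0 < d" "d \<le> r"
  shows "morrey_M p lam f x r \<le> ennreal (d powr (- lam)) * (\<integral>\<^sup>+ y. ennreal (\<bar>f y\<bar> powr p) \<partial>lebesgue)"
  unfolding morrey_M_lebesgue
  using assms
  by (intro mult_mono nn_integral_mono ennreal_leI powr_mono2') (auto simp: indicator_def)

lemma measurable_abs_powr_indicator:
  assumes "f \<in> borel_measurable M" "A \<in> sets M"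
  shows "(\<lambda>y. ennreal (\<bar>f y\<bar> powr p) * indicator A y) \<in> borel_measurable M"
proof -
  note [measurable] = assms
  show ?thesis by measurable
qed

lemma morrey_M_cmult:
  assumes "f \<in> borel_measurable lebesgue"
  shows "morrey_M p lam (\<lambda>y. c * f y) x r = ennreal (\<bar>c\<bar> powr p) * morrey_M p lam f x r"
proof -
  have "(\<integral>\<^sup>+ y \<in> ball x r. ennreal (\<bar>c * f y\<bar> powr p) \<partial>lebesgue) =
      (\<integral>\<^sup>+ y. ennreal (\<bar>c\<bar> powr p) * (ennreal (\<bar>f y\<bar> powr p) * indicator (ball x r) y) \<partial>lebesgue)"
    by (auto simp: abs_mult powr_mult ennreal_mult mult.assoc)
  also have "\<dots> = ennreal (\<bar>c\<bar> powr p) * (\<integral>\<^sup>+ y \<in> ball x r. ennreal (\<bar>f y\<bar> powr p) \<partial>lebesgue)"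
    using assms by (intro nn_integral_cmult measurable_abs_powr_indicator) auto
  finally show ?thesis
    by (simp add: morrey_M_lebesgue mult_ac)
qed

lemma morrey_sup_cmult_le:
  assumes "f \<in> borel_measurable lebesgue"
  shows "morrey_sup p lam (\<lambda>y. c * f y) \<le> ennreal (\<bar>c\<bar> powr p) * morrey_sup p lam f"
  by (intro morrey_sup_leI) (auto simp: morrey_M_cmult[OF assms] intro!: mult_left_mono morrey_M_le_morrey_sup)

text \<open>Bounding both terms by their maximum avoids convexity and covers every p \<ge>
  0.\<close>

lemma abs_add_powr_le:
  fixes a b :: real
  assumes "0 \<le> p"
  shows "\<bar>a + b\<bar> powr p \<le> 2 powr p * (\<bar>a\<bar> powr p + \<bar>b\<bar> powr p)"
proof -
  have "\<bar>a + b\<bar> powr p \<le> (2 * max \<bar>a\<bar> \<bar>b\<bar>) powr p"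
    using assms by (intro powr_mono2) auto
  also have "\<dots> = 2 powr p * max \<bar>a\<bar> \<bar>b\<bar> powr p"
    by (simp add: powr_mult)
  also have "max \<bar>a\<bar> \<bar>b\<bar> powr p \<le> \<bar>a\<bar> powr p + \<bar>b\<bar> powr p"
    by (auto simp: max_def)
  finally show ?thesis by simp
qed

text \<open>A quasi-triangle inequality for the p-th power of the norm is enough and avoids Minkowski.\<close>
lemma morrey_sup_add_le:
  assumes p: "0 \<le> p" and f: "f \<in> borel_measurable lebesgue" and g: "g \<in> borel_measurable lebesgue"
  shows "morrey_sup p lam (\<lambda>y. f y + g y) \<le> ennreal (2 powr p) * (morrey_sup p lam f + morrey_sup p lam g)"
proof (rule morrey_sup_leI)
  fix x :: 'a and r :: real assume r: "0 < r"
  have "(\<integral>\<^sup>+ y \<in> ball x r. ennreal (\<bar>f y + g y\<bar> powr p) \<partial>lebesgue) \<le>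
     (\<integral>\<^sup>+ y. ennreal (2 powr p) * (ennreal (\<bar>f y\<bar> powr p) * indicator (ball x r) y
       + ennreal (\<bar>g y\<bar> powr p) * indicator (ball x r) y) \<partial>lebesgue)"
    using abs_add_powr_le[OF p]
    by (intro nn_integral_mono)
      (auto simp: indicator_def ennreal_mult[symmetric] ennreal_plus[symmetric] simp del: ennreal_plus intro!: ennreal_leI)
  also have "\<dots> = ennreal (2 powr p) * ((\<integral>\<^sup>+ y \<in> ball x r. ennreal (\<bar>f y\<bar> powr p) \<partial>lebesgue)
       + (\<integral>\<^sup>+ y \<in> ball x r. ennreal (\<bar>g y\<bar> powr p) \<partial>lebesgue))"
    using f g
    by (subst nn_integral_cmult nn_integral_add;
        (intro borel_measurable_add measurable_abs_powr_indicator)?; simp?)+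
  finally have "morrey_M p lam (\<lambda>y. f y + g y) x r \<le>
      ennreal (r powr - lam) * (ennreal (2 powr p) * ((\<integral>\<^sup>+ y \<in> ball x r. ennreal (\<bar>f y\<bar> powr p) \<partial>lebesgue)
       + (\<integral>\<^sup>+ y \<in> ball x r. ennreal (\<bar>g y\<bar> powr p) \<partial>lebesgue)))"
    unfolding morrey_M_lebesgue by (rule mult_left_mono) simp
  also have "\<dots> = ennreal (2 powr p) * (morrey_M p lam f x r + morrey_M p lam g x r)"
    unfolding morrey_M_lebesgue by (simp add: algebra_simps)
  also have "\<dots> \<le> ennreal (2 powr p) * (morrey_sup p lam f + morrey_sup p lam g)"
    by (intro mult_left_mono add_mono morrey_M_le_morrey_sup r) auto
  finally show "morrey_M p lam (\<lambda>y. f y + g y) x r \<le> \<dots>" .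
qed

section \<open>Vanishing of the Morrey functional at small radii\<close>

text \<open>The limit condition of \<open>V0_morrey\<close> without membership in the Morrey space.
  It can thus be asked of the constant 1, which lies outside that space when \<open>lam\<close> is
  below the dimension.\<close>

definition vanishing_at_0 :: "real \<Rightarrow> real \<Rightarrow> ('a::euclidean_space \<Rightarrow> real) \<Rightarrow> bool" where
  "vanishing_at_0 p lam f \<longleftrightarrow> ((\<lambda>r. SUP x. morrey_M p lam f x r) \<longlongrightarrow> 0) (at_right 0)"

lemma vanishing_at_0D:
  assumes "vanishing_at_0 p lam f" "0 < e"
  obtains d where "0 < d" "\<And>x r. 0 < r \<Longrightarrow> r < d \<Longrightarrow> morrey_M p lam f x r \<le> ennreal e"
proof -
  have "\<forall>\<^sub>F r in at_right 0. (SUP x. morrey_M p lam f x r) < ennreal e"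
    using assms by (intro order_tendstoD) (auto simp: vanishing_at_0_def)
  then obtain d where "0 < d" "\<And>r. 0 < r \<Longrightarrow> r < d \<Longrightarrow> (SUP x. morrey_M p lam f x r) < ennreal e"
    by (auto simp: eventually_at_right_field)
  then show ?thesis
    using that[of d] by (meson SUP_lessD UNIV_I less_imp_le)
qed

lemma vanishing_at_0_cmult:
  assumes "f \<in> borel_measurable lebesgue" "vanishing_at_0 p lam f"
  shows "vanishing_at_0 p lam (\<lambda>y. c * f y)"
  using tendsto_mult_ennreal[of "\<lambda>_. ennreal (\<bar>c\<bar> powr p)" "ennreal (\<bar>c\<bar> powr p)" "at_right 0"
      "\<lambda>r. SUP x. morrey_M p lam f x r" 0] assms(2)
  by (simp add: vanishing_at_0_def morrey_M_cmult[OF assms(1)] SUP_mult_left_ennreal)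

text \<open>Balls have volume proportional to r to the dimension, so the functional is a constant
  times a positive power of r.\<close>

lemma vanishing_at_0_one:
  assumes "lam < real DIM('a)"
  shows "vanishing_at_0 p lam (\<lambda>_::'a::euclidean_space. 1)"
proof -
  have eq: "morrey_M p lam (\<lambda>_. 1) x r = ennreal (unit_ball_vol (real DIM('a)) * r powr (real DIM('a) - lam))"
    if "0 < r" for x :: 'a and r
    using that
    by (simp add: morrey_M_def emeasure_ball ennreal_mult[symmetric] powr_diff powr_minus powr_realpow field_simps)
  have "((\<lambda>r. unit_ball_vol (real DIM('a)) * r powr (real DIM('a) - lam)) \<longlongrightarrow> unit_ball_vol (real DIM('a)) * 0 powr (real DIM('a) - lam)) (at_right 0)"
    using assms by (intro tendsto_intros) (auto simp: eventually_at_filter)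
  then have "((\<lambda>r. ennreal (unit_ball_vol (real DIM('a)) * r powr (real DIM('a) - lam))) \<longlongrightarrow> 0) (at_right 0)"
    using tendsto_ennrealI by fastforce
  then show ?thesis
    unfolding vanishing_at_0_def
    by (rule Lim_transform_eventually) (auto simp: eventually_at_filter eq)
qed

text \<open>Below a threshold radius the majorant v controls u; above it the global integral does.
  The threshold depends only on v and e, so \<open>d\<close> serves all u at once. This turns
  dominated convergence of p-th power integrals into convergence in the Morrey sense.\<close>

lemma morrey_sup_le_if_nn_integral_small:
  fixes v :: "'a::euclidean_space \<Rightarrow> real"
  assumes "0 \<le> lam" "0 \<le> p" "vanishing_at_0 p lam v" "0 < e"
  obtains d where "0 < d"
    "\<And>u. (\<And>y. \<bar>u y\<bar> \<le> \<bar>v y\<bar>) \<Longrightarrow> (\<integral>\<^sup>+ y. ennreal (\<bar>u y\<bar> powr p) \<partial>lebesgue) \<le> ennreal d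
      \<Longrightarrow> morrey_sup p lam u \<le> ennreal e"
proof -
  obtain d where d: "0 < d" "\<And>x r. 0 < r \<Longrightarrow> r < d \<Longrightarrow> morrey_M p lam v x r \<le> ennreal e"
    using vanishing_at_0D[OF assms(3,4)] by blast
  show ?thesis
  \<comment> \<open>The factor \<open>d powr lam\<close> cancels the largest weight that occurs for
    radii r \<ge> d.\<close>
  proof (rule that[of "e * d powr lam"])
    fix u assume u: "\<And>y. \<bar>u y\<bar> \<le> \<bar>v y\<bar>"
      "(\<integral>\<^sup>+ y. ennreal (\<bar>u y\<bar> powr p) \<partial>lebesgue) \<le> ennreal (e * d powr lam)"
    show "morrey_sup p lam u \<le> ennreal e"
    proof (rule morrey_sup_leI)
      fix x :: 'a and r :: real assume r: "0 < r"
      show "morrey_M p lam u x r \<le> ennreal e"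
      proof (cases "r < d")
        case True
        then show ?thesis
          using d(2)[OF r True, of x] morrey_M_mono[OF assms(2), where f = u and g = v and x = x and r = r and lam = lam] u(1) by (auto intro: order.trans)
      next
        case False
        have "morrey_M p lam u x r \<le> ennreal (d powr (- lam)) * ennreal (e * d powr lam)"
          by (rule order.trans[OF morrey_M_le_nn_integral[OF assms(1) d(1)] mult_left_mono[OF u(2)]])
            (use False in auto)
        also have "\<dots> = ennreal e"
          using d(1) assms(4) by (simp add: ennreal_mult[symmetric] powr_minus)
        finally show ?thesis .
      qed
    qed
  qed (use d assms in auto)
qed

section \<open>Approximable functions\<close>

text \<open>Approximants are taken from \<open>bump_algebra\<close>, where closure under sums and
  products is immediate; smoothness is extracted only at the end. Errors are measured by the
  extended-real p-th power of the norm, so no finiteness has to be tracked.\<close>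

definition approximable :: "real \<Rightarrow> real \<Rightarrow> ('a::euclidean_space \<Rightarrow> real) \<Rightarrow> bool" where
  "approximable p lam f \<longleftrightarrow> f \<in> borel_measurable lebesgue \<and>
    (\<forall>e>0. \<exists>g. bump_algebra g \<and> compact (closure {x. g x \<noteq> 0}) \<and>
      morrey_sup p lam (\<lambda>y. f y - g y) \<le> ennreal e)"

lemma bump_algebra_measurable: "bump_algebra g \<Longrightarrow> g \<in> borel_measurable lebesgue"
  using bump_algebra_continuous_on[of g UNIV]
  by (auto intro!: measurable_completion borel_measurable_continuous_onI)

text \<open>An approximant of a nearby h also approximates f, by the quasi-triangle
  inequality.\<close>

lemma approximable_closed:
  assumes p: "0 \<le> p" and f: "f \<in> borel_measurable lebesgue"
    and h: "\<And>e. 0 < e \<Longrightarrow> \<exists>h. approximable p lam h \<and> morrey_sup p lam (\<lambda>y. f y - h y) \<le> ennreal e"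
  shows "approximable p lam f"
  unfolding approximable_def
proof (intro conjI allI impI f)
  fix e :: real assume e: "0 < e"
  \<comment> \<open>Chosen so that the quasi-triangle bound \<open>2 powr p * (d + d)\<close> equals
    \<open>e\<close>.\<close>
  define d where "d = e / (2 * 2 powr p)"
  have d: "0 < d" using e by (simp add: d_def)
  obtain h where h: "approximable p lam h" "morrey_sup p lam (\<lambda>y. f y - h y) \<le> ennreal d"
    using h[OF d] by blast
  then obtain g where g: "bump_algebra g" "compact (closure {x. g x \<noteq> 0})"
    "morrey_sup p lam (\<lambda>y. h y - g y) \<le> ennreal d"
    using d by (auto simp: approximable_def)
  have [measurable]: "h \<in> borel_measurable lebesgue" "g \<in> borel_measurable lebesgue" "f \<in> borel_measurable lebesgue"
    using h g f by (auto simp: approximable_def bump_algebra_measurable)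
  have "morrey_sup p lam (\<lambda>y. f y - g y) = morrey_sup p lam (\<lambda>y. (f y - h y) + (h y - g y))"
    by simp
  also have "\<dots> \<le> ennreal (2 powr p) * (morrey_sup p lam (\<lambda>y. f y - h y) + morrey_sup p lam (\<lambda>y. h y - g y))"
    by (rule morrey_sup_add_le[OF p]) measurable
  also have "\<dots> \<le> ennreal (2 powr p) * (ennreal d + ennreal d)"
    by (intro mult_left_mono add_mono h g) auto
  also have "\<dots> = ennreal e"
    using d by (simp add: ennreal_plus[symmetric] ennreal_mult[symmetric] del: ennreal_plus) (simp add: d_def)
  finally show "\<exists>g. bump_algebra g \<and> compact (closure {x. g x \<noteq> 0}) \<and> morrey_sup p lam (\<lambda>y. f y - g y) \<le> ennreal e"
    using g by blast
qed

lemma compact_closure_subset: "compact (closure T) \<Longrightarrow> S \<subseteq> T \<Longrightarrow> compact (closure S)"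
  for S T :: "'a::euclidean_space set"
  by (meson bounded_closure bounded_subset closure_subset compact_closure)

lemma approximable_add:
  assumes p: "0 \<le> p" and fg: "approximable p lam f1" "approximable p lam f2"
  shows "approximable p lam (\<lambda>y. f1 y + f2 y)"
  unfolding approximable_def
proof (intro conjI allI impI)
  show "(\<lambda>y. f1 y + f2 y) \<in> borel_measurable lebesgue"
    using fg by (auto simp: approximable_def)
  fix e :: real assume e: "0 < e"
  define d where "d = e / (2 * 2 powr p)"
  have d: "0 < d" using e by (simp add: d_def)
  obtain g1 where g1: "bump_algebra g1" "compact (closure {x. g1 x \<noteq> 0})"
    "morrey_sup p lam (\<lambda>y. f1 y - g1 y) \<le> ennreal d"
    using fg d by (auto simp: approximable_def)
  obtain g2 where g2: "bump_algebra g2" "compact (closure {x. g2 x \<noteq> 0})"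
    "morrey_sup p lam (\<lambda>y. f2 y - g2 y) \<le> ennreal d"
    using fg d by (auto simp: approximable_def)
  have [measurable]: "f1 \<in> borel_measurable lebesgue" "f2 \<in> borel_measurable lebesgue"
    "g1 \<in> borel_measurable lebesgue" "g2 \<in> borel_measurable lebesgue"
    using fg g1 g2 by (auto simp: approximable_def bump_algebra_measurable)
  have "morrey_sup p lam (\<lambda>y. f1 y + f2 y - (g1 y + g2 y)) = morrey_sup p lam (\<lambda>y. (f1 y - g1 y) + (f2 y - g2 y))"
    by (simp add: algebra_simps)
  also have "\<dots> \<le> ennreal (2 powr p) * (morrey_sup p lam (\<lambda>y. f1 y - g1 y) + morrey_sup p lam (\<lambda>y. f2 y - g2 y))"
    by (rule morrey_sup_add_le[OF p]) measurable
  also have "\<dots> \<le> ennreal (2 powr p) * (ennreal d + ennreal d)"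
    by (intro mult_left_mono add_mono g1 g2) auto
  also have "\<dots> = ennreal e"
    using d by (simp add: ennreal_plus[symmetric] ennreal_mult[symmetric] del: ennreal_plus) (simp add: d_def)
  finally have "morrey_sup p lam (\<lambda>y. f1 y + f2 y - (g1 y + g2 y)) \<le> ennreal e" .
  moreover have "compact (closure {x. g1 x + g2 x \<noteq> 0})"
    by (rule compact_closure_subset[of "{x. g1 x \<noteq> 0} \<union> {x. g2 x \<noteq> 0}"]) (use g1 g2 in \<open>auto simp: closure_Un\<close>)
  ultimately show "\<exists>g. bump_algebra g \<and> compact (closure {x. g x \<noteq> 0}) \<and> morrey_sup p lam (\<lambda>y. f1 y + f2 y - g y) \<le> ennreal e"
    using bump_algebra.add[OF g1(1) g2(1)] by (intro exI[of _ "\<lambda>x. g1 x + g2 x"]) auto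
qed

lemma approximable_cmult:
  assumes f: "approximable p lam f"
  shows "approximable p lam (\<lambda>y. c * f y)"
  unfolding approximable_def
proof (intro conjI allI impI)
  show "(\<lambda>y. c * f y) \<in> borel_measurable lebesgue"
    using f by (auto simp: approximable_def)
  fix e :: real assume e: "0 < e"
  \<comment> \<open>The added 1 keeps the denominator positive when c = 0.\<close>
  define d where "d = e / (\<bar>c\<bar> powr p + 1)"
  have d: "0 < d" using e by (simp add: d_def add_nonneg_pos)
  obtain g where g: "bump_algebra g" "compact (closure {x. g x \<noteq> 0})"
    "morrey_sup p lam (\<lambda>y. f y - g y) \<le> ennreal d"
    using f d by (auto simp: approximable_def)
  have [measurable]: "f \<in> borel_measurable lebesgue" "g \<in> borel_measurable lebesgue"
    using f g by (auto simp: approximable_def bump_algebra_measurable)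
  have "morrey_sup p lam (\<lambda>y. c * f y - c * g y) = morrey_sup p lam (\<lambda>y. c * (f y - g y))"
    by (simp add: algebra_simps)
  also have "\<dots> \<le> ennreal (\<bar>c\<bar> powr p) * ennreal d"
    by (rule order.trans[OF morrey_sup_cmult_le mult_left_mono[OF g(3)]]) auto
  also have "\<bar>c\<bar> powr p * d \<le> (\<bar>c\<bar> powr p + 1) * d"
    using d by (intro mult_right_mono) auto
  then have "ennreal (\<bar>c\<bar> powr p) * ennreal d \<le> ennreal ((\<bar>c\<bar> powr p + 1) * d)"
    using d by (simp add: ennreal_mult[symmetric] ennreal_leI)
  also have "(\<bar>c\<bar> powr p + 1) * d = e"
    using add_nonneg_pos[OF powr_ge_zero[of "\<bar>c\<bar>" p] zero_less_one] unfolding d_def by simp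
  finally have "morrey_sup p lam (\<lambda>y. c * f y - c * g y) \<le> ennreal e" .
  moreover have "compact (closure {x. c * g x \<noteq> 0})"
    by (rule compact_closure_subset[OF g(2)]) auto
  ultimately show "\<exists>g. bump_algebra g \<and> compact (closure {x. g x \<noteq> 0}) \<and> morrey_sup p lam (\<lambda>y. c * f y - g y) \<le> ennreal e"
    using g(1) by (intro exI[of _ "\<lambda>x. c * g x"]) (auto intro: bump_algebra.intros)
qed

lemma approximable_zero: "approximable p lam (\<lambda>y. 0)"
  unfolding approximable_def
  by (auto intro!: exI[of _ "\<lambda>y. 0"] bump_algebra.intros morrey_sup_leI simp: morrey_M_def)

lemma approximable_sum:
  assumes "0 \<le> p" "finite A" "\<And>i. i \<in> A \<Longrightarrow> approximable p lam (f i)"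
  shows "approximable p lam (\<lambda>y. \<Sum>i\<in>A. f i y)"
  using assms(2,3)
  by (induction A rule: finite_induct) (auto intro: approximable_zero approximable_add[OF assms(1)])

lemma approximable_bump_algebra:
  assumes "bump_algebra g" "compact (closure {x. g x \<noteq> 0})"
  shows "approximable p lam g"
  unfolding approximable_def
  using assms by (auto intro!: exI[of _ g] morrey_sup_leI bump_algebra_measurable simp: morrey_M_def)

section \<open>From indicators to functions of bounded support\<close>

text \<open>The majorant w has two roles: its integrable p-th power yields dominated convergence of
  the integrals of the errors, and its vanishing at 0 upgrades this to the Morrey
  functional.\<close>

lemma approximable_dominated_limit:
  fixes f w :: "'a::euclidean_space \<Rightarrow> real"
  assumes lam: "0 \<le> lam" and p: "0 < p" and w: "vanishing_at_0 p lam w"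
    and meas: "f \<in> borel_measurable lebesgue" "w \<in> borel_measurable lebesgue"
    and int: "(\<integral>\<^sup>+ y. ennreal (\<bar>w y\<bar> powr p) \<partial>lebesgue) < \<infinity>"
    and h: "\<And>k::nat. approximable p lam (h k)"
    and le: "\<And>k y. \<bar>f y - h k y\<bar> \<le> \<bar>w y\<bar>"
    and lim: "\<And>y. (\<lambda>k. h k y) \<longlonglongrightarrow> f y"
  shows "approximable p lam f"
proof (rule approximable_closed[OF less_imp_le[OF p] meas(1)])
  fix e :: real assume "0 < e"
  obtain d where d: "0 < d" and small:
    "\<And>u. (\<And>y. \<bar>u y\<bar> \<le> \<bar>w y\<bar>) \<Longrightarrow> (\<integral>\<^sup>+ y. ennreal (\<bar>u y\<bar> powr p) \<partial>lebesgue) \<le> ennreal d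
      \<Longrightarrow> morrey_sup p lam u \<le> ennreal e"
    using morrey_sup_le_if_nn_integral_small[OF lam less_imp_le[OF p] w \<open>0 < e\<close>] by blast
  have [measurable]: "f \<in> borel_measurable lebesgue" "w \<in> borel_measurable lebesgue"
    "h k \<in> borel_measurable lebesgue" for k
    using meas h by (auto simp: approximable_def)
  have "(\<lambda>k. \<integral>\<^sup>+ y. ennreal (\<bar>f y - h k y\<bar> powr p) \<partial>lebesgue) \<longlonglongrightarrow> integral\<^sup>N lebesgue (\<lambda>_::'a. 0)"
  proof (rule nn_integral_dominated_convergence[where w = "\<lambda>y. ennreal (\<bar>w y\<bar> powr p)"])
    show "AE y in lebesgue. ennreal (\<bar>f y - h k y\<bar> powr p) \<le> ennreal (\<bar>w y\<bar> powr p)" for k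
      using le p by (auto intro!: AE_I2 ennreal_leI powr_mono2)
    \<comment> \<open>Continuity of the power at base 0 relies on p > 0.\<close>
    have "(\<lambda>k. ennreal (\<bar>f y - h k y\<bar> powr p)) \<longlonglongrightarrow> ennreal (\<bar>f y - f y\<bar> powr p)" for y
      using p by (intro tendsto_ennrealI tendsto_powr' tendsto_rabs tendsto_diff tendsto_const lim) auto
    then show "AE y in lebesgue. (\<lambda>k. ennreal (\<bar>f y - h k y\<bar> powr p)) \<longlonglongrightarrow> 0"
      by simp
  qed (use int in measurable)
  then have "\<forall>\<^sub>F k in sequentially. (\<integral>\<^sup>+ y. ennreal (\<bar>f y - h k y\<bar> powr p) \<partial>lebesgue) < ennreal d"
    using d by (intro order_tendstoD(2)) auto
  then obtain k where "(\<integral>\<^sup>+ y. ennreal (\<bar>f y - h k y\<bar> powr p) \<partial>lebesgue) < ennreal d"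
    by (auto simp: eventually_sequentially)
  then have "morrey_sup p lam (\<lambda>y. f y - h k y) \<le> ennreal e"
    using le by (intro small) auto
  with h show "\<exists>h. approximable p lam h \<and> morrey_sup p lam (\<lambda>y. f y - h y) \<le> ennreal e"
    by blast
qed

lemma vanishing_at_0_mono:
  assumes "vanishing_at_0 p lam g" "0 \<le> p" "\<And>y. \<bar>f y\<bar> \<le> \<bar>g y\<bar>"
  shows "vanishing_at_0 p lam f"
  unfolding vanishing_at_0_def
  by (rule tendsto_sandwich[OF _ _ tendsto_const assms(1)[unfolded vanishing_at_0_def]])
    (auto intro!: always_eventually SUP_mono' morrey_M_mono assms)

text \<open>A normalised sum s of bumps satisfies 0 < s < 1 on the union and s = 0 off it. Hence 1 -
  (1 - s)^k tends pointwise to the indicator, with error at most the indicator itself.\<close>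

lemma approximable_indicator_balls:
  fixes F :: "'a::euclidean_space set"
  assumes lam: "0 \<le> lam" "lam < real DIM('a)" and p: "0 < p" and F: "finite F" "\<And>a. a \<in> F \<Longrightarrow> 0 < \<rho> a"
  shows "approximable p lam (indicator (\<Union>a\<in>F. ball a (\<rho> a)))"
proof -
  define W where "W = (\<Union>a\<in>F. ball a (\<rho> a))"
  \<comment> \<open>Each bump is at most 1, so dividing by \<open>card F + 1\<close> forces s < 1
    everywhere.\<close>
  define s where "s x = (\<Sum>a\<in>F. flat_exp 0 ((\<rho> a)\<^sup>2 - (x - a) \<bullet> (x - a))) * inverse (real (card F) + 1)" for x
  define h where "h k x = 1 + (- 1) * (1 + (- 1) * s x) ^ k" for k :: nat and x
  have pos_iff: "0 < (\<rho> a)\<^sup>2 - (x - a) \<bullet> (x - a) \<longleftrightarrow> x \<in> ball a (\<rho> a)" if "a \<in> F" for a x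
    using F(2)[OF that] power_mono_iff[of "\<rho> a" "norm (x - a)" 2]
    by (simp add: dot_square_norm dist_norm norm_minus_commute not_le[symmetric] del: not_le)
  have s0: "s x = 0" if "x \<notin> W" for x
    using that pos_iff by (auto simp: s_def W_def flat_exp_def intro!: sum.neutral)
  have s_pos: "0 < s x" if x: "x \<in> W" for x
  proof -
    obtain a where "a \<in> F" "x \<in> ball a (\<rho> a)" using x by (auto simp: W_def)
    then have "0 < (\<Sum>a\<in>F. flat_exp 0 ((\<rho> a)\<^sup>2 - (x - a) \<bullet> (x - a)))"
      using pos_iff by (intro sum_pos2[OF F(1), of a]) (auto simp: flat_exp_def)
    then show ?thesis by (simp add: s_def)
  qed
  have s_less: "s x < 1" for x
  proof -
    have "(\<Sum>a\<in>F. flat_exp 0 ((\<rho> a)\<^sup>2 - (x - a) \<bullet> (x - a))) \<le> (\<Sum>a\<in>F. 1)"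
      by (intro sum_mono) (auto simp: flat_exp_def)
    then show ?thesis by (simp add: s_def field_simps)
  qed
  have bdd: "bounded W"
    using F(1) by (auto simp: W_def)
  have W_borel: "W \<in> sets borel"
    by (simp add: W_def open_UN)
  then have W_sets: "W \<in> sets lebesgue"
    by (simp add: sets_completionI_sets)
  have "approximable p lam (indicator W)"
  proof (rule approximable_dominated_limit[OF lam(1) p, of "indicator W" _ h])
    show "vanishing_at_0 p lam (indicator W :: 'a \<Rightarrow> real)"
      using p by (intro vanishing_at_0_mono[OF vanishing_at_0_one[OF lam(2)]]) (auto simp: indicator_def)
    have "(\<integral>\<^sup>+ y. ennreal (\<bar>indicator W y\<bar> powr p) \<partial>lebesgue) = (\<integral>\<^sup>+ y. indicator W y \<partial>lebesgue)"
      using p by (intro nn_integral_cong) (auto simp: indicator_def)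
    also have "\<dots> < \<infinity>"
      unfolding nn_integral_completion using emeasure_bounded_finite[OF bdd] W_borel by simp
    finally show "(\<integral>\<^sup>+ y. ennreal (\<bar>indicator W y\<bar> powr p) \<partial>lebesgue) < \<infinity>" .
    show "approximable p lam (h k)" for k
    proof (rule approximable_bump_algebra)
      show "bump_algebra (h k)"
        unfolding h_def s_def by (intro bump_algebra.intros bump_algebra_power bump_algebra_sum F(1))
      have "{x. h k x \<noteq> 0} \<subseteq> W"
        using s0 by (force simp: h_def)
      then show "compact (closure {x. h k x \<noteq> 0})"
        using bdd by (meson bounded_subset compact_closure)
    qed
    show "\<bar>indicator W y - h k y\<bar> \<le> \<bar>indicator W y\<bar>" for k y
      using s0[of y] s_pos[of y] s_less[of y] power_le_one[of "1 - s y" k] zero_le_power[of "1 - s y" k]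
      by (cases "y \<in> W") (auto simp: h_def)
    show "(\<lambda>k. h k y) \<longlonglongrightarrow> indicator W y" for y
    proof (cases "y \<in> W")
      case True
      have "(\<lambda>k. 1 + (- 1) * (1 + (- 1) * s y) ^ k) \<longlonglongrightarrow> 1 + (- 1) * 0"
        using s_pos[OF True] s_less[of y] by (intro tendsto_intros LIMSEQ_power_zero) auto
      then show ?thesis using True by (simp add: h_def)
    qed (simp add: h_def s0)
  qed (use W_sets in auto)
  then show ?thesis by (simp add: W_def)
qed

text \<open>Regularity places A between a compact T and an open U with U - T of small measure, and
  finitely many balls inside U cover T. Differences of indicators are bounded by 1, which vanishes
  at 0, so small measure gives a small Morrey functional.\<close>

lemma approximable_indicator:
  fixes A :: "'a::euclidean_space set"
  assumes lam: "0 \<le> lam" "lam < real DIM('a)" and p: "0 < p" and A: "A \<in> sets lebesgue" "bounded A"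
  shows "approximable p lam (indicator A)"
proof (rule approximable_closed)
  fix e :: real assume "0 < e"
  obtain d where d: "0 < d" and small:
    "\<And>u::'a \<Rightarrow> real. (\<And>y. \<bar>u y\<bar> \<le> \<bar>1\<bar>) \<Longrightarrow> (\<integral>\<^sup>+ y. ennreal (\<bar>u y\<bar> powr p) \<partial>lebesgue) \<le> ennreal d
      \<Longrightarrow> morrey_sup p lam u \<le> ennreal e"
    using morrey_sup_le_if_nn_integral_small[OF lam(1) less_imp_le[OF p] vanishing_at_0_one[OF lam(2)] \<open>0 < e\<close>]
    by blast
  obtain U where U: "open U" "A \<subseteq> U" "U - A \<in> lmeasurable" "emeasure lebesgue (U - A) < ennreal (d / 2)"
    using sets_lebesgue_outer_open[OF A(1), of "d / 2"] d by auto
  obtain T where T: "closed T" "T \<subseteq> A" "A - T \<in> lmeasurable" "emeasure lebesgue (A - T) < ennreal (d / 2)"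
    using sets_lebesgue_inner_closed[OF A(1), of "d / 2"] d by auto
  have "compact T"
    using T A(2) by (meson bounded_subset compact_eq_bounded_closed)
  have "\<forall>a\<in>T. \<exists>r>0. ball a r \<subseteq> U"
    using T U open_contains_ball by blast
  then obtain \<rho> where \<rho>: "\<And>a. a \<in> T \<Longrightarrow> 0 < \<rho> a" "\<And>a. a \<in> T \<Longrightarrow> ball a (\<rho> a) \<subseteq> U"
    by metis
  obtain F where F: "F \<subseteq> T" "finite F" "T \<subseteq> (\<Union>a\<in>F. ball a (\<rho> a))"
    using compactE_image[OF \<open>compact T\<close>, of T "\<lambda>a. ball a (\<rho> a)"] \<rho>(1) by force
  define W where "W = (\<Union>a\<in>F. ball a (\<rho> a))"
  have W: "T \<subseteq> W" "W \<subseteq> U"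
    using F \<rho>(2) by (auto simp: W_def)
  have "approximable p lam (indicator W)"
    unfolding W_def using F \<rho>(1) by (intro approximable_indicator_balls lam p) auto
  moreover have "morrey_sup p lam (\<lambda>y. indicator A y - indicator W y) \<le> ennreal e"
  proof (rule small)
    \<comment> \<open>The integrand takes only the values 0 and 1, and since W lies between T and U,
      it is supported in the union of U - A and A - T.\<close>
    have "(\<integral>\<^sup>+ y. ennreal (\<bar>indicator A y - indicator W y\<bar> powr p) \<partial>lebesgue) \<le>
        (\<integral>\<^sup>+ y. indicator ((U - A) \<union> (A - T)) y \<partial>lebesgue)"
      using W T U p by (intro nn_integral_mono) (auto simp: indicator_def)
    also have "\<dots> = emeasure lebesgue ((U - A) \<union> (A - T))"
      using U T by (intro nn_integral_indicator) auto
    also have "\<dots> \<le> emeasure lebesgue (U - A) + emeasure lebesgue (A - T)"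
      using U T by (intro emeasure_subadditive) auto
    also have "\<dots> \<le> ennreal (d / 2) + ennreal (d / 2)"
      using U T by (intro add_mono) auto
    also have "\<dots> = ennreal d"
      using d by (simp add: ennreal_plus[symmetric] del: ennreal_plus)
    finally show "(\<integral>\<^sup>+ y. ennreal (\<bar>indicator A y - indicator W y\<bar> powr p) \<partial>lebesgue) \<le> ennreal d" .
  qed (auto simp: indicator_def)
  ultimately show "\<exists>h. approximable p lam h \<and> morrey_sup p lam (\<lambda>y. indicator A y - h y) \<le> ennreal e"
    by blast
qed (use p A in auto)

lemma approximable_simple_function:
  fixes s :: "'a::euclidean_space \<Rightarrow> real"
  assumes lam: "0 \<le> lam" "lam < real DIM('a)" and p: "0 < p"
    and s: "simple_function lebesgue s" "bounded {x. s x \<noteq> 0}"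
  shows "approximable p lam s"
proof -
  have fin: "finite (range s)" and sets: "\<And>c. s -` {c} \<in> sets lebesgue"
    using simple_functionD[OF s(1)] by auto
  have "s = (\<lambda>x. \<Sum>c\<in>range s. c * indicator (s -` {c}) x)"
    using fin by (auto simp: fun_eq_iff indicator_def if_distrib sum.delta cong: if_cong)
  \<comment> \<open>The level set of 0 is unbounded, but its term is identically zero; every other
    level set lies in the bounded support.\<close>
  moreover have "approximable p lam (\<lambda>x. c * indicator (s -` {c}) x)" for c
  proof (cases "c = 0")
    case False
    then have "bounded (s -` {c})"
      by (auto intro!: bounded_subset[OF s(2)])
    then show ?thesis
      by (intro approximable_cmult approximable_indicator lam p sets)
  qed (simp add: approximable_zero)
  ultimately show ?thesis
    using approximable_sum[OF less_imp_le[OF p] fin, of lam "\<lambda>c x. c * indicator (s -` {c}) x"] by simp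
qed

text \<open>Simple functions with \<bar>s\<bar> \<le> 2 \<bar>f\<bar> converging pointwise to f
  vanish wherever f does, and the errors are dominated by 3 f, which inherits integrability and
  vanishing at 0 from f.\<close>

lemma approximable_bounded_support:
  fixes f :: "'a::euclidean_space \<Rightarrow> real"
  assumes lam: "0 \<le> lam" "lam < real DIM('a)" and p: "0 < p"
    and f: "f \<in> borel_measurable lebesgue" "vanishing_at_0 p lam f" "bounded {x. f x \<noteq> 0}"
    and int: "(\<integral>\<^sup>+ y. ennreal (\<bar>f y\<bar> powr p) \<partial>lebesgue) < \<infinity>"
  shows "approximable p lam f"
proof -
  obtain s where s: "\<And>i. simple_function lebesgue (s i)" "\<And>x. (\<lambda>i. s i x) \<longlonglongrightarrow> f x"
    "\<And>i x. dist (s i x) 0 \<le> 2 * dist (f x) 0"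
    using borel_measurable_implies_sequence_metric[OF f(1), of 0] by auto
  have [measurable]: "f \<in> borel_measurable lebesgue" by (fact f)
  show ?thesis
  proof (rule approximable_dominated_limit[OF lam(1) p, of "\<lambda>y. 3 * f y" _ s])
    show "vanishing_at_0 p lam (\<lambda>y. 3 * f y)"
      by (rule vanishing_at_0_cmult[OF f(1,2)])
    have "(\<integral>\<^sup>+ y. ennreal (\<bar>3 * f y\<bar> powr p) \<partial>lebesgue) =
        (\<integral>\<^sup>+ y. ennreal (3 powr p) * ennreal (\<bar>f y\<bar> powr p) \<partial>lebesgue)"
      by (simp add: abs_mult powr_mult ennreal_mult)
    also have "\<dots> = ennreal (3 powr p) * (\<integral>\<^sup>+ y. ennreal (\<bar>f y\<bar> powr p) \<partial>lebesgue)"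
      by (rule nn_integral_cmult) measurable
    also have "\<dots> < \<infinity>"
      using int by (simp add: ennreal_mult_less_top)
    finally show "(\<integral>\<^sup>+ y. ennreal (\<bar>3 * f y\<bar> powr p) \<partial>lebesgue) < \<infinity>" .
    show "approximable p lam (s i)" for i
    proof (intro approximable_simple_function lam p s(1) bounded_subset[OF f(3)])
      show "{x. s i x \<noteq> 0} \<subseteq> {x. f x \<noteq> 0}"
        using s(3)[of i] by (auto simp: dist_real_def) (metis abs_le_zero_iff abs_zero mult_zero_right)
    qed
    show "\<bar>f y - s i y\<bar> \<le> \<bar>3 * f y\<bar>" for i y
      using s(3)[of i y] by (simp add: dist_real_def)
  qed (use s(2) in auto)
qed

section \<open>Truncation to a large ball\<close>

text \<open>Translating one fixed cover of \<open>cball 0 R\<close> by x covers the ball around x,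
  so the number of unit balls is independent of the centre.\<close>

lemma nn_integral_ball_le_unit_balls:
  fixes g :: "'a::euclidean_space \<Rightarrow> ennreal" and F :: "'a set"
  assumes g: "g \<in> borel_measurable lebesgue"
    and F: "finite F" "cball 0 R \<subseteq> (\<Union>c\<in>F. ball c 1)" and r: "r \<le> R"
    and le: "\<And>x. (\<integral>\<^sup>+ y \<in> ball x 1. g y \<partial>lebesgue) \<le> s"
  shows "(\<integral>\<^sup>+ y \<in> ball x r. g y \<partial>lebesgue) \<le> of_nat (card F) * s"
proof -
  have "(\<integral>\<^sup>+ y \<in> ball x r. g y \<partial>lebesgue) \<le> (\<integral>\<^sup>+ y. (\<Sum>c\<in>F. g y * indicator (ball (x + c) 1) y) \<partial>lebesgue)"
  proof (rule nn_integral_mono)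
    fix y
    show "g y * indicator (ball x r) y \<le> (\<Sum>c\<in>F. g y * indicator (ball (x + c) 1) y)"
    proof (cases "y \<in> ball x r")
      case True
      then have "y - x \<in> cball 0 R"
        using r by (auto simp: dist_norm norm_minus_commute)
      then obtain c where c: "c \<in> F" "y - x \<in> ball c 1"
        using F by blast
      then have "y \<in> ball (x + c) 1"
        by (simp add: dist_norm algebra_simps)
      then show ?thesis
        using True member_le_sum[OF c(1) _ F(1), of "\<lambda>c. g y * indicator (ball (x + c) 1) y"] by auto
    qed simp
  qed
  also have "\<dots> = (\<Sum>c\<in>F. \<integral>\<^sup>+ y \<in> ball (x + c) 1. g y \<partial>lebesgue)"
    using g by (intro nn_integral_sum borel_measurable_times_ennreal borel_measurable_indicator) auto
  also have "\<dots> \<le> (\<Sum>c\<in>F. s)"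
    by (intro sum_mono le)
  finally show ?thesis by simp
qed

text \<open>The thresholds d and R come from f alone and bound every truncation of f at small and
  large radii. Only then is N chosen, to make the integrals over unit balls small enough for the
  radii between d and R.\<close>

lemma V0inf_star_tail_small:
  fixes f :: "'a::euclidean_space \<Rightarrow> real"
  assumes lam: "0 \<le> lam" and p: "0 < p" and f: "f \<in> V0inf_star_morrey p lam" and e: "0 < e"
  obtains N :: nat where "morrey_sup p lam (\<lambda>y. f y * indicator (- ball 0 (real N)) y) \<le> ennreal e"
proof -
  have meas: "f \<in> borel_measurable lebesgue"
    using f by (auto simp: V0inf_star_morrey_def V0_morrey_def morrey_space_def Lp_loc_def)
  have "vanishing_at_0 p lam f"
    using f by (auto simp: V0inf_star_morrey_def V0_morrey_def vanishing_at_0_def)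
  then obtain d where d: "0 < d" "\<And>x r. 0 < r \<Longrightarrow> r < d \<Longrightarrow> morrey_M p lam f x r \<le> ennreal e"
    using vanishing_at_0D[OF _ e] by blast
  have "\<forall>\<^sub>F r in at_top. (SUP x. morrey_M p lam f x r) < ennreal e"
    using f e by (intro order_tendstoD) (auto simp: V0inf_star_morrey_def Vinf_morrey_def)
  then obtain R where R: "\<And>x r. R \<le> r \<Longrightarrow> morrey_M p lam f x r \<le> ennreal e"
    unfolding eventually_at_top_linorder by (meson SUP_lessD UNIV_I less_imp_le)
  obtain F where F: "finite F" "cball (0::'a) R \<subseteq> (\<Union>c\<in>F. ball c 1)"
    using compactE_image[OF compact_cball[of "0::'a" R], where C = UNIV and f = "\<lambda>c. ball c 1"]
    by (metis UNIV_I UN_I centre_in_ball open_ball subsetI zero_less_one)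
  \<comment> \<open>C collects the largest weight and the number of covering balls for the
    intermediate radii; dividing by C + 1 below also handles C = 0.\<close>
  define C where "C = d powr (- lam) * real (card F)"
  define \<delta> where "\<delta> = e / (C + 1)"
  have C: "0 \<le> C" by (simp add: C_def)
  then have \<delta>: "0 < \<delta>" using e by (simp add: \<delta>_def)
  have "\<forall>\<^sub>F N in sequentially. (SUP x. \<integral>\<^sup>+ y \<in> ball x 1.
          ennreal (\<bar>f y\<bar> powr p) * indicator (- ball 0 (real N)) y \<partial>lborel) < ennreal \<delta>"
    using f \<delta> by (intro order_tendstoD) (auto simp: V0inf_star_morrey_def Vstar_morrey_def)
  then obtain N :: nat where N: "(SUP x. \<integral>\<^sup>+ y \<in> ball x 1.
          ennreal (\<bar>f y\<bar> powr p) * indicator (- ball 0 (real N)) y \<partial>lborel) < ennreal \<delta>"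
    by (auto simp: eventually_sequentially)
  define u where "u y = f y * indicator (- ball 0 (real N)) y" for y
  have u_powr: "ennreal (\<bar>u y\<bar> powr p) = ennreal (\<bar>f y\<bar> powr p) * indicator (- ball 0 (real N)) y" for y
    by (auto simp: u_def indicator_def)
  have u_le: "morrey_M p lam u x r \<le> morrey_M p lam f x r" for x r
    using p by (intro morrey_M_mono) (auto simp: u_def indicator_def)
  have unit: "(\<integral>\<^sup>+ y \<in> ball x 1. ennreal (\<bar>u y\<bar> powr p) \<partial>lebesgue) \<le> ennreal \<delta>" for x
    unfolding u_powr nn_integral_completion using SUP_lessD[OF N, of x] by (simp add: less_imp_le)
  have u_meas: "(\<lambda>y. ennreal (\<bar>u y\<bar> powr p)) \<in> borel_measurable lebesgue"
    unfolding u_powr using meas by (intro measurable_abs_powr_indicator) auto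
  have "morrey_sup p lam u \<le> ennreal e"
  proof (rule morrey_sup_leI)
    fix x :: 'a and r :: real assume r: "0 < r"
    \<comment> \<open>If R < d, the first two cases already exhaust all radii.\<close>
    consider "r < d" | "R \<le> r" | "d \<le> r" "r \<le> R" by linarith
    then show "morrey_M p lam u x r \<le> ennreal e"
    proof cases
      case 3
      have "morrey_M p lam u x r \<le> ennreal (d powr (- lam)) * (of_nat (card F) * ennreal \<delta>)"
        unfolding morrey_M_lebesgue
        by (intro mult_mono ennreal_leI powr_mono2' nn_integral_ball_le_unit_balls[OF u_meas F] unit)
          (use 3 d lam in auto)
      also have "\<dots> = ennreal (C * \<delta>)"
        using \<delta> by (simp add: C_def ennreal_of_nat_eq_real_of_nat ennreal_mult[symmetric] mult.assoc)
      also have "C * \<delta> \<le> (C + 1) * \<delta>"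
        using \<delta> by simp
      also have "\<dots> = e"
        using C by (simp add: \<delta>_def)
      finally show ?thesis by (simp add: ennreal_leI)
    qed (use u_le[of x r] d(2)[OF r] R[of r x] in \<open>auto intro: order.trans\<close>)
  qed
  then show ?thesis
    using that[of N] by (simp add: u_def[abs_def])
qed

text \<open>The truncation h has bounded support, is p-integrable because f is locally so, and
  inherits vanishing at 0; the discarded tail is small.\<close>

lemma V0inf_star_approximable:
  fixes f :: "'a::euclidean_space \<Rightarrow> real"
  assumes lam: "0 \<le> lam" "lam < real DIM('a)" and p: "0 < p" and f: "f \<in> V0inf_star_morrey p lam"
  shows "approximable p lam f"
proof (rule approximable_closed[OF less_imp_le[OF p]])
  show meas: "f \<in> borel_measurable lebesgue"
    using f by (auto simp: V0inf_star_morrey_def V0_morrey_def morrey_space_def Lp_loc_def)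
  have van: "vanishing_at_0 p lam f"
    using f by (auto simp: V0inf_star_morrey_def V0_morrey_def vanishing_at_0_def)
  have loc: "(\<integral>\<^sup>+ y \<in> K. ennreal (\<bar>f y\<bar> powr p) \<partial>lborel) < \<infinity>" if "compact K" for K
    using f that by (auto simp: V0inf_star_morrey_def V0_morrey_def morrey_space_def Lp_loc_def)
  fix e :: real assume "0 < e"
  then obtain N :: nat where N: "morrey_sup p lam (\<lambda>y. f y * indicator (- ball 0 (real N)) y) \<le> ennreal e"
    using V0inf_star_tail_small[OF lam(1) p f] by blast
  define h where "h y = f y * indicator (ball 0 (real N)) y" for y
  have "approximable p lam h"
  proof (rule approximable_bounded_support[OF lam p])
    show "h \<in> borel_measurable lebesgue"
      unfolding h_def using meas by (intro borel_measurable_times borel_measurable_indicator) auto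
    show "vanishing_at_0 p lam h"
      using p by (intro vanishing_at_0_mono[OF van]) (auto simp: h_def indicator_def)
    show "bounded {x. h x \<noteq> 0}"
      by (rule bounded_subset[OF bounded_ball[of 0 "real N"]]) (auto simp: h_def indicator_def)
    have "(\<integral>\<^sup>+ y. ennreal (\<bar>h y\<bar> powr p) \<partial>lebesgue) \<le> (\<integral>\<^sup>+ y \<in> cball 0 (real N). ennreal (\<bar>f y\<bar> powr p) \<partial>lborel)"
      unfolding nn_integral_completion by (intro nn_integral_mono) (auto simp: h_def indicator_def)
    also have "\<dots> < \<infinity>" by (rule loc) simp
    finally show "(\<integral>\<^sup>+ y. ennreal (\<bar>h y\<bar> powr p) \<partial>lebesgue) < \<infinity>" .
  qed
  moreover have "(\<lambda>y. f y - h y) = (\<lambda>y. f y * indicator (- ball 0 (real N)) y)"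
    by (auto simp: h_def indicator_def)
  ultimately show "\<exists>h. approximable p lam h \<and> morrey_sup p lam (\<lambda>y. f y - h y) \<le> ennreal e"
    using N by auto
qed

section \<open>Passage to the Morrey norm\<close>

text \<open>Local integrability comes for free: a compact set lies in some ball around 0, whose
  weight is positive, so a finite functional there means a finite integral.\<close>

lemma morrey_spaceI:
  assumes "f \<in> borel_measurable lebesgue" "morrey_sup p lam f < \<infinity>"
  shows "f \<in> morrey_space p lam"
proof -
  have "(\<integral>\<^sup>+ y \<in> K. ennreal (\<bar>f y\<bar> powr p) \<partial>lborel) < \<infinity>" if K: "compact K" for K
  proof -
    obtain r where r: "0 < r" "K \<subseteq> ball 0 r"
      using bounded_subset_ballD[OF compact_imp_bounded[OF K], of 0] by auto
    have "(\<integral>\<^sup>+ y \<in> K. ennreal (\<bar>f y\<bar> powr p) \<partial>lborel) \<le> (\<integral>\<^sup>+ y \<in> ball 0 r. ennreal (\<bar>f y\<bar> powr p) \<partial>lborel)"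
      using r by (intro nn_integral_mono) (auto simp: indicator_def)
    also have "\<dots> < \<infinity>"
      using morrey_M_le_morrey_sup[OF r(1), of p lam f 0] assms(2) r(1)
      by (auto simp: morrey_M_def ennreal_mult_less_top less_top[symmetric] ennreal_mult_eq_top_iff top_unique)
    finally show ?thesis .
  qed
  with assms show ?thesis by (auto simp: morrey_space_def Lp_loc_def)
qed

theorem theorem5p3:
  fixes f :: "'n::euclidean_space \<Rightarrow> real" and p lam :: real
  assumes "0 \<le> lam" "lam < real DIM('n)" "1 \<le> p"
    and "f \<in> V0inf_star_morrey p lam"
  shows "\<forall>\<epsilon>>0. \<exists>g \<in> C0_inf. f - g \<in> morrey_space p lam \<and> morrey_norm p lam (f - g) < \<epsilon>"
proof (intro allI impI)
  fix \<epsilon> :: real assume \<epsilon>: "0 < \<epsilon>"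
  \<comment> \<open>The p-th root of e is half of \<epsilon>, which makes the final inequality
    strict.\<close>
  define e where "e = (\<epsilon> / 2) powr p"
  have e: "0 < e" using \<epsilon> by (simp add: e_def)
  have appr: "approximable p lam f"
    using assms by (intro V0inf_star_approximable) auto
  then obtain g where g: "bump_algebra g" "compact (closure {x. g x \<noteq> 0})"
    "morrey_sup p lam (f - g) \<le> ennreal e"
    using e by (auto simp: approximable_def fun_diff_def)
  have "f - g \<in> borel_measurable lebesgue"
    using appr bump_algebra_measurable[OF g(1)] by (auto simp: approximable_def fun_diff_def)
  then have "f - g \<in> morrey_space p lam"
    using g(3) by (intro morrey_spaceI) (auto simp: le_less_trans)
  moreover have "morrey_norm p lam (f - g) < \<epsilon>"
  proof -
    \<comment> \<open>The default value of \<open>enn2real\<close> at infinity does not interfere,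
      since the supremum is bounded by a real number.\<close>
    have "enn2real (morrey_sup p lam (f - g)) \<le> e"
      using g(3) e by (simp add: enn2real_leI)
    then have "morrey_norm p lam (f - g) \<le> e powr (1 / p)"
      unfolding morrey_norm_def using assms(3) by (intro powr_mono2) auto
    also have "\<dots> < \<epsilon>"
      using \<epsilon> assms(3) by (simp add: e_def powr_powr)
    finally show ?thesis .
  qed
  moreover have "g \<in> C0_inf"
    using g by (simp add: C0_inf_def bump_algebra_imp_Cinf)
  ultimately show "\<exists>g \<in> C0_inf. f - g \<in> morrey_space p lam \<and> morrey_norm p lam (f - g) < \<epsilon>"
    by blast
qed

end
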